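(* Let $a>0$ and let $M=\mathbb{R}^4$ with coordinates $(t,x,y,z)$ carry the Gödel metric $$ds^2=a^2\Big(dt^2-dx^2-dz^2+\tfrac12 e^{2x}\,dy^2+2e^{x}\,dt\,dy\Big).$$ Let $L_{abc}$ be the tensor field on $M$ satisfying $L_{abc}=-L_{bac}$ and $L_{abc}+L_{bca}+L_{cab}=0$ with $$L_{txy}=-\tfrac{a^2}{8}e^{x},\quad L_{tyx}=\tfrac{a^2}{8}e^{x},\quad L_{txt}=-\tfrac{a^2}{8},\quad L_{xyy}=\tfrac{3a^2}{16}e^{2x},$$ all components not determined by these through the two index symmetries being zero (the cyclic identity then gives $L_{xyt}=\tfrac{a^2}{4}e^{x}$). Then $L_{abc}$ satisfies the Riemann-Lanczos equations $$R_{abcd}=L_{abc;d}-L_{abd;c}+L_{cda;b}-L_{cdb;a}$$ on $M$, and $\pounds_\xi L_{abc}=0$ for the three Killing vector fields $\xi=\partial_t,\ \partial_y,\ \partial_z$.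
   Context: Coordinates are $x^1=t,\ x^2=x,\ x^3=y,\ x^4=z$; the term $2e^x\,dt\,dy$ means $g_{ty}=g_{yt}=a^2e^x$. A semicolon denotes covariant differentiation with the Levi-Civita connection, $L_{abc;d}=\nabla_dL_{abc}$; $\pounds_\xi$ is the Lie derivative. The curvature convention is $R^a{}_{bcd}=\partial_c\Gamma^a_{bd}-\partial_d\Gamma^a_{bc}+\Gamma^a_{mc}\Gamma^m_{bd}-\Gamma^a_{md}\Gamma^m_{bc}$ and $R_{abcd}=g_{am}R^m{}_{bcd}$. No trace or differential gauge condition is imposed on $L_{abc}$. *)

theory Defs
  imports "HOL-Analysis.Analysis"
begin

text \<open>
  Tensor fields on the coordinate space \<open>real ^ 'n\<close> are given by their components in the global
  chart; indices appear in their classical order after the point.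
\<close>

type_synonym 'n tensor2 = "real ^ 'n \<Rightarrow> 'n \<Rightarrow> 'n \<Rightarrow> real"
type_synonym 'n tensor3 = "real ^ 'n \<Rightarrow> 'n \<Rightarrow> 'n \<Rightarrow> 'n \<Rightarrow> real"
type_synonym 'n metric = "real ^ 'n \<Rightarrow> real ^ 'n ^ 'n"

definition pderiv_at :: "'n \<Rightarrow> (real ^ 'n \<Rightarrow> real) \<Rightarrow> real ^ 'n \<Rightarrow> real" where
  "pderiv_at i f p = deriv (\<lambda>s. f (p + s *\<^sub>R axis i 1)) 0"

text \<open>\<open>christoffel g p m b c\<close> is \<open>\<Gamma>\<close> with upper index \<open>m\<close> and lower indices \<open>b, c\<close>,
  for the Levi-Civita connection of \<open>g\<close>.\<close>

definition christoffel :: "('n::finite) metric \<Rightarrow> real ^ 'n \<Rightarrow> 'n \<Rightarrow> 'n \<Rightarrow> 'n \<Rightarrow> real" where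
  "christoffel g p m b c = 1/2 * (\<Sum>k\<in>UNIV. matrix_inv (g p) $ m $ k *
     (pderiv_at b (\<lambda>q. g q $ k $ c) p + pderiv_at c (\<lambda>q. g q $ k $ b) p
      - pderiv_at k (\<lambda>q. g q $ b $ c) p))"

text \<open>Here the first index is the upper one.\<close>

definition riemann_up ::
    "('n::finite) metric \<Rightarrow> real ^ 'n \<Rightarrow> 'n \<Rightarrow> 'n \<Rightarrow> 'n \<Rightarrow> 'n \<Rightarrow> real" where
  "riemann_up g p a b c d =
     pderiv_at c (\<lambda>q. christoffel g q a b d) p - pderiv_at d (\<lambda>q. christoffel g q a b c) p
     + (\<Sum>m\<in>UNIV. christoffel g p a m c * christoffel g p m b d)
     - (\<Sum>m\<in>UNIV. christoffel g p a m d * christoffel g p m b c)"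

definition riemann_down ::
    "('n::finite) metric \<Rightarrow> real ^ 'n \<Rightarrow> 'n \<Rightarrow> 'n \<Rightarrow> 'n \<Rightarrow> 'n \<Rightarrow> real" where
  "riemann_down g p a b c d = (\<Sum>m\<in>UNIV. g p $ a $ m * riemann_up g p m b c d)"

text \<open>The last index is the direction of differentiation: \<open>cov_deriv3 g L p a b c d\<close> is
  \<open>L\<^sub>a\<^sub>b\<^sub>c\<^sub>;\<^sub>d\<close> at \<open>p\<close>.\<close>

definition cov_deriv3 ::
    "('n::finite) metric \<Rightarrow> 'n tensor3 \<Rightarrow> real ^ 'n \<Rightarrow> 'n \<Rightarrow> 'n \<Rightarrow> 'n \<Rightarrow> 'n \<Rightarrow> real" where
  "cov_deriv3 g L p a b c d = pderiv_at d (\<lambda>q. L q a b c) p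
     - (\<Sum>m\<in>UNIV. christoffel g p m a d * L p m b c)
     - (\<Sum>m\<in>UNIV. christoffel g p m b d * L p a m c)
     - (\<Sum>m\<in>UNIV. christoffel g p m c d * L p a b m)"

definition lie_deriv2 :: "(real ^ 'n \<Rightarrow> real ^ 'n) \<Rightarrow> ('n::finite) tensor2 \<Rightarrow> 'n tensor2" where
  "lie_deriv2 \<xi> T p a b =
     (\<Sum>m\<in>UNIV. \<xi> p $ m * pderiv_at m (\<lambda>q. T q a b) p)
     + (\<Sum>m\<in>UNIV. T p m b * pderiv_at a (\<lambda>q. \<xi> q $ m) p)
     + (\<Sum>m\<in>UNIV. T p a m * pderiv_at b (\<lambda>q. \<xi> q $ m) p)"

definition lie_deriv3 :: "(real ^ 'n \<Rightarrow> real ^ 'n) \<Rightarrow> ('n::finite) tensor3 \<Rightarrow> 'n tensor3" where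
  "lie_deriv3 \<xi> T p a b c =
     (\<Sum>m\<in>UNIV. \<xi> p $ m * pderiv_at m (\<lambda>q. T q a b c) p)
     + (\<Sum>m\<in>UNIV. T p m b c * pderiv_at a (\<lambda>q. \<xi> q $ m) p)
     + (\<Sum>m\<in>UNIV. T p a m c * pderiv_at b (\<lambda>q. \<xi> q $ m) p)
     + (\<Sum>m\<in>UNIV. T p a b m * pderiv_at c (\<lambda>q. \<xi> q $ m) p)"

definition killing_field :: "('n::finite) metric \<Rightarrow> (real ^ 'n \<Rightarrow> real ^ 'n) \<Rightarrow> bool" where
  "killing_field g \<xi> \<longleftrightarrow> (\<forall>p a b. lie_deriv2 \<xi> (\<lambda>q c d. g q $ c $ d) p a b = 0)"

definition coord_field :: "'n \<Rightarrow> real ^ 'n \<Rightarrow> real ^ 'n" where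
  "coord_field i p = axis i 1"

definition riemann_lanczos :: "('n::finite) metric \<Rightarrow> 'n tensor3 \<Rightarrow> bool" where
  "riemann_lanczos g L \<longleftrightarrow> (\<forall>p a b c d. riemann_down g p a b c d =
     cov_deriv3 g L p a b c d - cov_deriv3 g L p a b d c
     + cov_deriv3 g L p c d a b - cov_deriv3 g L p c d b a)"

text \<open>On \<open>real ^ 4\<close> the coordinates \<open>t, x, y, z\<close> have the indices \<open>1, 2, 3, 4\<close>.\<close>

definition godel_metric :: "real \<Rightarrow> 4 metric" where
  "godel_metric a p = a\<^sup>2 *\<^sub>R vector
     [vector [1,           0,  exp (p $ 2),             0],
      vector [0,          -1,  0,                       0],
      vector [exp (p $ 2), 0,  1/2 * exp (2 * p $ 2),   0],
      vector [0,           0,  0,                      -1]]"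

text \<open>The ten index triples in the last clause are the four prescribed ones, the triple
  \<open>(2,3,1)\<close> that the cyclic identity adds to them, and the images of these five under
  exchange of the first two indices.\<close>

definition godel_lanczos_data :: "real \<Rightarrow> 4 tensor3 \<Rightarrow> bool" where
  "godel_lanczos_data a L \<longleftrightarrow>
     (\<forall>p i j k. L p i j k = - L p j i k) \<and>
     (\<forall>p i j k. L p i j k + L p j k i + L p k i j = 0) \<and>
     (\<forall>p. L p 1 2 3 = - (a\<^sup>2 / 8) * exp (p $ 2)) \<and>
     (\<forall>p. L p 1 3 2 = a\<^sup>2 / 8 * exp (p $ 2)) \<and>
     (\<forall>p. L p 1 2 1 = - (a\<^sup>2 / 8)) \<and>
     (\<forall>p. L p 2 3 3 = 3 * a\<^sup>2 / 16 * exp (2 * p $ 2)) \<and>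
     (\<forall>p i j k. (i, j, k) \<notin> {(1,2,3), (2,1,3), (1,3,2), (3,1,2), (1,2,1), (2,1,1),
                              (2,3,3), (3,2,3), (2,3,1), (3,2,1)} \<longrightarrow> L p i j k = 0)"

end

(*
  In the coframe dt, dx, e^x dy, dz the metric has constant coefficients, and so does every
  tensor of the theorem. Hence each coordinate component is a constant times exp (k x), where
  k is the number of lower minus the number of upper indices y; d/dx multiplies it by k and all
  other partial derivatives kill it. The exponentials cancel from the Riemann-Lanczos equations,
  and what remains is an identity between rational constants for each choice of indices.
*)
theory Submission
  imports Defs
begin

section \<open>Derivatives along coordinate fields, matrix inverses and products of
  exponentials\<close>

lemma pderiv_at_exp:
  "pderiv_at i (\<lambda>q. c * exp (k * q $ j)) p = (if i = j then k * (c * exp (k * p $ j)) else 0)"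
proof -
  have "((\<lambda>s. c * exp (k * (p + s *\<^sub>R axis i 1) $ j)) has_real_derivative
      (if i = j then k * (c * exp (k * p $ j)) else 0)) (at 0)"
    by (auto simp: axis_def intro!: derivative_eq_intros)
  then show ?thesis
    unfolding pderiv_at_def by (rule DERIV_imp_deriv)
qed

lemma pderiv_at_const [simp]: "pderiv_at i (\<lambda>q. c) p = 0"
  by (simp add: pderiv_at_def)

lemma sum_axis_mult:
  fixes f :: "'n::finite \<Rightarrow> real"
  shows "(\<Sum>m\<in>UNIV. axis i 1 $ m * f m) = f i"
  by (simp add: axis_def if_distrib [of "\<lambda>x. x * _"] cong: if_cong)

text \<open>A coordinate field has constant components, so only the transport term survives.\<close>

lemma lie_deriv2_coord_field:
  "lie_deriv2 (coord_field i) T p b c = pderiv_at i (\<lambda>q. T q b c) p"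
  by (simp add: lie_deriv2_def coord_field_def sum_axis_mult)

lemma lie_deriv3_coord_field:
  "lie_deriv3 (coord_field i) T p b c d = pderiv_at i (\<lambda>q. T q b c d) p"
  by (simp add: lie_deriv3_def coord_field_def sum_axis_mult)

text \<open>\<open>matrix_inv\<close> chooses some two-sided inverse. For square matrices over a
  field a right inverse is also a left inverse, and inverses are unique.\<close>

lemma matrix_inv_eqI:
  fixes A B :: "'a::field ^ 'n ^ 'n"
  assumes "A ** B = mat 1"
  shows "matrix_inv A = B"
proof -
  have "A ** matrix_inv A = mat 1 \<and> matrix_inv A ** A = mat 1"
    unfolding matrix_inv_def
  proof (rule someI)
    show "A ** B = mat 1 \<and> B ** A = mat 1"
      using assms matrix_left_right_inverse by blast
  qed
  then have inv: "matrix_inv A ** A = mat 1"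
    by (rule conjunct2)
  have "matrix_inv A = matrix_inv A ** (A ** B)"
    by (simp only: assms matrix_mul_rid)
  also have "\<dots> = B"
    by (simp only: matrix_mul_assoc inv matrix_mul_lid)
  finally show ?thesis .
qed

lemma vector_4:
  "(vector [x, y, z, w] :: 'a::zero ^ 4) $ 1 = x"
  "(vector [x, y, z, w] :: 'a ^ 4) $ 2 = y"
  "(vector [x, y, z, w] :: 'a ^ 4) $ 3 = z"
  "(vector [x, y, z, w] :: 'a ^ 4) $ 4 = w"
  unfolding vector_def by simp_all

text \<open>The exponent \<open>m\<close> is kept apart from \<open>k + l\<close> so that the weight
  of a contracted index can cancel in the premise.\<close>

lemma exp_mult_exp:
  fixes c d k l m x :: real
  assumes "k + l = m"
  shows "c * exp (k * x) * (d * exp (l * x)) = c * d * exp (m * x)"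
  unfolding assms [symmetric] by (simp add: distrib_right exp_add)

section \<open>The constant coefficients that remain once the exponentials are split off\<close>

definition y_weight :: "4 \<Rightarrow> real" where
  "y_weight i = (if i = 3 then 1 else 0)"

definition frame_metric :: "real ^ 4 ^ 4" where
  "frame_metric = vector
     [vector [1,  0,  1,   0],
      vector [0, -1,  0,   0],
      vector [1,  0,  1/2, 0],
      vector [0,  0,  0,  -1]]"

definition frame_metric_inv :: "real ^ 4 ^ 4" where
  "frame_metric_inv = vector
     [vector [-1,  0,  2,  0],
      vector [ 0, -1,  0,  0],
      vector [ 2,  0, -2,  0],
      vector [ 0,  0,  0, -1]]"

text \<open>These are the coordinate Christoffel symbols at \<open>x = 0\<close>, hence symmetric in
  \<open>b\<close> and \<open>c\<close>. They are not the connection coefficients of the coframe,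
  which is anholonomic.\<close>

definition frame_christoffel :: "4 \<Rightarrow> 4 \<Rightarrow> 4 \<Rightarrow> real" where
  "frame_christoffel m b c =
     (if (m, b, c) \<in> {(1,1,2), (1,2,1)} then 1
      else if (m, b, c) \<in> {(1,2,3), (1,3,2), (2,1,3), (2,3,1), (2,3,3)} then 1/2
      else if (m, b, c) \<in> {(3,1,2), (3,2,1)} then -1
      else 0)"

text \<open>The values are those at \<open>x = 0\<close>, divided by \<open>a\<^sup>2\<close>. The
  entry 1/4 comes from the cyclic identity, the other entries from the prescribed components and
  antisymmetry.\<close>

definition frame_lanczos :: "4 \<Rightarrow> 4 \<Rightarrow> 4 \<Rightarrow> real" where
  "frame_lanczos i j k =
     (if (i, j, k) \<in> {(1,2,3), (1,2,1), (3,1,2)} then -1/8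
      else if (i, j, k) \<in> {(2,1,3), (2,1,1), (1,3,2)} then 1/8
      else if (i, j, k) = (2,3,3) then 3/16
      else if (i, j, k) = (3,2,3) then -3/16
      else if (i, j, k) = (2,3,1) then 1/4
      else if (i, j, k) = (3,2,1) then -1/4
      else 0)"

definition godel_lanczos :: "real \<Rightarrow> 4 tensor3" where
  "godel_lanczos a p i j k = a\<^sup>2 * frame_lanczos i j k *
     exp ((y_weight i + y_weight j + y_weight k) * p $ 2)"

section \<open>The metric, its inverse and the Christoffel symbols\<close>

lemma godel_metric_eq:
  "godel_metric a p $ i $ j =
     a\<^sup>2 * frame_metric $ i $ j * exp ((y_weight i + y_weight j) * p $ 2)"
proof -
  have "\<forall>i j. godel_metric a p $ i $ j =
     a\<^sup>2 * frame_metric $ i $ j * exp ((y_weight i + y_weight j) * p $ 2)"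
    unfolding forall_4
    by (simp add: godel_metric_def frame_metric_def y_weight_def vector_4)
  then show ?thesis by blast
qed

lemma frame_metric_mult_inv:
  "(\<Sum>k\<in>UNIV. frame_metric $ i $ k * frame_metric_inv $ k $ j) = (if i = j then 1 else 0)"
proof -
  have "\<forall>i j. (\<Sum>k\<in>UNIV. frame_metric $ i $ k * frame_metric_inv $ k $ j) = (if i = j then 1 else 0)"
    unfolding forall_4 sum_4
    by (simp add: frame_metric_def frame_metric_inv_def vector_4)
  then show ?thesis by blast
qed

lemma matrix_inv_godel_metric:
  assumes "a \<noteq> 0"
  shows "matrix_inv (godel_metric a p) $ i $ j =
    frame_metric_inv $ i $ j / a\<^sup>2 * exp (- (y_weight i + y_weight j) * p $ 2)"
proof -
  \<comment> \<open>The inverse metric has two upper indices, so both weights enter with a minus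
    sign.\<close>
  define B :: "real ^ 4 ^ 4" where "B = (\<chi> i j. frame_metric_inv $ i $ j / a\<^sup>2 *
    exp (- (y_weight i + y_weight j) * p $ 2))"
  have "(godel_metric a p ** B) $ i $ j = (mat 1 :: real ^ 4 ^ 4) $ i $ j" for i j
  proof -
    have "(godel_metric a p ** B) $ i $ j =
      (\<Sum>k\<in>UNIV. frame_metric $ i $ k * frame_metric_inv $ k $ j) *
        exp ((y_weight i - y_weight j) * p $ 2)"
    proof -
      \<comment> \<open>The weight of \<open>k\<close> cancels, and the exponential can leave the
        sum over \<open>k\<close>.\<close>
      have "godel_metric a p $ i $ k * B $ k $ j =
          frame_metric $ i $ k * frame_metric_inv $ k $ j * exp ((y_weight i - y_weight j) * p $ 2)"
        for k
        using exp_mult_exp [of "y_weight i + y_weight k" "- (y_weight k + y_weight j)"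
            "y_weight i - y_weight j" "a\<^sup>2 * frame_metric $ i $ k" "p $ 2"
            "frame_metric_inv $ k $ j / a\<^sup>2"] assms
        by (simp add: B_def godel_metric_eq)
      then show ?thesis
        by (simp add: matrix_matrix_mult_def sum_distrib_right)
    qed
    \<comment> \<open>Off the diagonal the sum is 0; on it the exponent is 0.\<close>
    also have "\<dots> = (mat 1 :: real ^ 4 ^ 4) $ i $ j"
      by (simp add: frame_metric_mult_inv mat_def)
    finally show ?thesis .
  qed
  then have "matrix_inv (godel_metric a p) = B"
    by (intro matrix_inv_eqI) (simp add: vec_eq_iff)
  then show ?thesis
    by (simp add: B_def)
qed

definition frame_dmetric :: "4 \<Rightarrow> 4 \<Rightarrow> 4 \<Rightarrow> real" where
  "frame_dmetric i j k = (if i = 2 then (y_weight j + y_weight k) * frame_metric $ j $ k else 0)"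

text \<open>The derivative vanishes unless \<open>i = 2\<close>, and that index has weight 0. Adding
  \<open>y_weight i\<close> to the exponent therefore changes nothing, but makes the exponent
  symmetric in all three indices, as the Christoffel formula requires.\<close>

lemma pderiv_godel_metric:
  "pderiv_at i (\<lambda>q. godel_metric a q $ j $ k) p =
     a\<^sup>2 * frame_dmetric i j k * exp ((y_weight i + y_weight j + y_weight k) * p $ 2)"
  by (simp add: godel_metric_eq pderiv_at_exp frame_dmetric_def y_weight_def)

lemma frame_christoffel_eq:
  "frame_christoffel m b c = 1/2 * (\<Sum>k\<in>UNIV. frame_metric_inv $ m $ k *
     (frame_dmetric b k c + frame_dmetric c k b - frame_dmetric k b c))"
proof -
  have "\<forall>m b c. frame_christoffel m b c = 1/2 * (\<Sum>k\<in>UNIV. frame_metric_inv $ m $ k *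
     (frame_dmetric b k c + frame_dmetric c k b - frame_dmetric k b c))"
    unfolding forall_4 sum_4
    by (simp add: frame_christoffel_def frame_metric_def frame_metric_inv_def
        frame_dmetric_def y_weight_def vector_4)
  then show ?thesis by blast
qed

lemma christoffel_godel:
  assumes "a \<noteq> 0"
  shows "christoffel (godel_metric a) p m b c =
    frame_christoffel m b c * exp ((y_weight b + y_weight c - y_weight m) * p $ 2)"
proof -
  let ?D = "\<lambda>k. frame_dmetric b k c + frame_dmetric c k b - frame_dmetric k b c"
  have "matrix_inv (godel_metric a p) $ m $ k *
      (pderiv_at b (\<lambda>q. godel_metric a q $ k $ c) p + pderiv_at c (\<lambda>q. godel_metric a q $ k $ b) p
       - pderiv_at k (\<lambda>q. godel_metric a q $ b $ c) p) =
      frame_metric_inv $ m $ k * ?D k * exp ((y_weight b + y_weight c - y_weight m) * p $ 2)" for k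
  proof -
    have "pderiv_at b (\<lambda>q. godel_metric a q $ k $ c) p + pderiv_at c (\<lambda>q. godel_metric a q $ k $ b) p
        - pderiv_at k (\<lambda>q. godel_metric a q $ b $ c) p =
        a\<^sup>2 * ?D k * exp ((y_weight b + y_weight c + y_weight k) * p $ 2)"
      by (simp add: pderiv_godel_metric algebra_simps)
    then show ?thesis
      using exp_mult_exp [of "- (y_weight m + y_weight k)" "y_weight b + y_weight c + y_weight k"
          "y_weight b + y_weight c - y_weight m" "frame_metric_inv $ m $ k / a\<^sup>2" "p $ 2"
          "a\<^sup>2 * ?D k"] assms
      by (simp add: matrix_inv_godel_metric)
  qed
  then show ?thesis
    by (simp add: christoffel_def frame_christoffel_eq sum_distrib_right)
qed

section \<open>The curvature tensor\<close>

definition frame_riemann :: "4 \<Rightarrow> 4 \<Rightarrow> 4 \<Rightarrow> 4 \<Rightarrow> real" where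
  "frame_riemann a b c d =
     (if c = 2 then (y_weight b + y_weight d - y_weight a) * frame_christoffel a b d else 0)
     - (if d = 2 then (y_weight b + y_weight c - y_weight a) * frame_christoffel a b c else 0)
     + (\<Sum>m\<in>UNIV. frame_christoffel m b d * frame_christoffel a m c)
     - (\<Sum>m\<in>UNIV. frame_christoffel m b c * frame_christoffel a m d)"

lemma riemann_up_godel:
  assumes "r \<noteq> 0"
  shows "riemann_up (godel_metric r) p a b c d =
    frame_riemann a b c d * exp ((y_weight b + y_weight c + y_weight d - y_weight a) * p $ 2)"
proof -
  have "christoffel (godel_metric r) p a m k * christoffel (godel_metric r) p m b l =
      frame_christoffel m b l * frame_christoffel a m k *
      exp ((y_weight b + y_weight k + y_weight l - y_weight a) * p $ 2)" for m k l
    unfolding christoffel_godel [OF assms]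
    by (subst mult.commute, rule exp_mult_exp) simp
  then have prod: "(\<Sum>m\<in>UNIV. christoffel (godel_metric r) p a m k * christoffel (godel_metric r) p m b l) =
      (\<Sum>m\<in>UNIV. frame_christoffel m b l * frame_christoffel a m k) *
      exp ((y_weight b + y_weight k + y_weight l - y_weight a) * p $ 2)" for k l
    by (simp add: sum_distrib_right)
  have deriv: "pderiv_at k (\<lambda>q. christoffel (godel_metric r) q a b l) p =
      (if k = 2 then (y_weight b + y_weight l - y_weight a) * frame_christoffel a b l else 0) *
      exp ((y_weight b + y_weight k + y_weight l - y_weight a) * p $ 2)" for k l
    by (simp add: christoffel_godel [OF assms] pderiv_at_exp y_weight_def)
  \<comment> \<open>Exchanging \<open>c\<close> and \<open>d\<close> only reorders the weights, so
    all four terms of the curvature share one exponential.\<close>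
  have "y_weight b + y_weight d + y_weight c - y_weight a =
      y_weight b + y_weight c + y_weight d - y_weight a"
    by simp
  then show ?thesis
    unfolding riemann_up_def frame_riemann_def prod deriv
    by (simp only: distrib_right left_diff_distrib)
qed

lemma riemann_down_godel:
  assumes "r \<noteq> 0"
  shows "riemann_down (godel_metric r) p a b c d =
    r\<^sup>2 * (\<Sum>m\<in>UNIV. frame_metric $ a $ m * frame_riemann m b c d) *
      exp ((y_weight a + y_weight b + y_weight c + y_weight d) * p $ 2)"
proof -
  have "godel_metric r p $ a $ m * riemann_up (godel_metric r) p m b c d =
      r\<^sup>2 * frame_metric $ a $ m * frame_riemann m b c d *
      exp ((y_weight a + y_weight b + y_weight c + y_weight d) * p $ 2)" for m
    unfolding riemann_up_godel [OF assms] godel_metric_eq by (rule exp_mult_exp) simp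
  then show ?thesis
    by (simp add: riemann_down_def sum_distrib_left sum_distrib_right mult.assoc)
qed

section \<open>The covariant derivative of the Lanczos tensor\<close>

definition frame_dlanczos :: "4 \<Rightarrow> 4 \<Rightarrow> 4 \<Rightarrow> 4 \<Rightarrow> real" where
  "frame_dlanczos a b c d =
     (if d = 2 then (y_weight a + y_weight b + y_weight c) * frame_lanczos a b c else 0)
     - (\<Sum>m\<in>UNIV. frame_christoffel m a d * frame_lanczos m b c)
     - (\<Sum>m\<in>UNIV. frame_christoffel m b d * frame_lanczos a m c)
     - (\<Sum>m\<in>UNIV. frame_christoffel m c d * frame_lanczos a b m)"

lemma cov_deriv3_godel_lanczos:
  assumes "r \<noteq> 0"
  shows "cov_deriv3 (godel_metric r) (godel_lanczos r) p a b c d =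
    r\<^sup>2 * frame_dlanczos a b c d *
      exp ((y_weight a + y_weight b + y_weight c + y_weight d) * p $ 2)"
proof -
  let ?e = "exp ((y_weight a + y_weight b + y_weight c + y_weight d) * p $ 2)"
  have deriv: "pderiv_at d (\<lambda>q. godel_lanczos r q a b c) p = r\<^sup>2 *
      (if d = 2 then (y_weight a + y_weight b + y_weight c) * frame_lanczos a b c else 0) * ?e"
    by (simp add: godel_lanczos_def pderiv_at_exp y_weight_def)
  \<comment> \<open>Only the balance of weights matters, so one statement serves the contractions in
    all three index positions.\<close>
  have prod: "christoffel (godel_metric r) p m k l * godel_lanczos r p i j h =
      frame_christoffel m k l * (r\<^sup>2 * frame_lanczos i j h) * ?e"
    if "y_weight k + y_weight l + y_weight i + y_weight j + y_weight h =
      y_weight a + y_weight b + y_weight c + y_weight d + y_weight m" for m k l i j h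
    unfolding christoffel_godel [OF assms] godel_lanczos_def
    by (rule exp_mult_exp) (use that in simp)
  have
    "(\<Sum>m\<in>UNIV. christoffel (godel_metric r) p m a d * godel_lanczos r p m b c) =
      r\<^sup>2 * (\<Sum>m\<in>UNIV. frame_christoffel m a d * frame_lanczos m b c) * ?e"
    "(\<Sum>m\<in>UNIV. christoffel (godel_metric r) p m b d * godel_lanczos r p a m c) =
      r\<^sup>2 * (\<Sum>m\<in>UNIV. frame_christoffel m b d * frame_lanczos a m c) * ?e"
    "(\<Sum>m\<in>UNIV. christoffel (godel_metric r) p m c d * godel_lanczos r p a b m) =
      r\<^sup>2 * (\<Sum>m\<in>UNIV. frame_christoffel m c d * frame_lanczos a b m) * ?e"
    by (simp_all add: prod sum_distrib_left sum_distrib_right mult.left_commute)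
  then show ?thesis
    unfolding cov_deriv3_def frame_dlanczos_def deriv
    by (simp only: left_diff_distrib right_diff_distrib)
qed

section \<open>Existence and uniqueness of the tensor with the given data\<close>

lemma frame_lanczos_antisym: "frame_lanczos i j k = - frame_lanczos j i k"
proof -
  have "\<forall>i j k. frame_lanczos i j k = - frame_lanczos j i k"
    unfolding forall_4
    by (simp add: frame_lanczos_def)
  then show ?thesis by blast
qed

lemma frame_lanczos_cyclic:
  "frame_lanczos i j k + frame_lanczos j k i + frame_lanczos k i j = 0"
proof -
  have "\<forall>i j k. frame_lanczos i j k + frame_lanczos j k i + frame_lanczos k i j = 0"
    unfolding forall_4
    by (simp add: frame_lanczos_def)
  then show ?thesis by blast
qed

lemma frame_lanczos_eq_0:
  assumes "(i, j, k) \<notin> {(1,2,3), (2,1,3), (1,3,2), (3,1,2), (1,2,1), (2,1,1),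
      (2,3,3), (3,2,3), (2,3,1), (3,2,1)}"
  shows "frame_lanczos i j k = 0"
proof -
  have *: "\<forall>i j k. (i, j, k) \<notin> {(1,2,3), (2,1,3), (1,3,2), (3,1,2), (1,2,1), (2,1,1),
      (2,3,3), (3,2,3), (2,3,1), (3,2,1)} \<longrightarrow> frame_lanczos i j k = 0"
    unfolding forall_4
    by (simp add: frame_lanczos_def)
  show ?thesis
    by (rule * [rule_format, OF assms])
qed

lemma godel_lanczos_data_godel_lanczos: "godel_lanczos_data a (godel_lanczos a)"
  unfolding godel_lanczos_data_def
proof (intro conjI allI impI)
  fix p :: "real ^ 4" and i j k :: 4
  show "godel_lanczos a p i j k = - godel_lanczos a p j i k"
    using frame_lanczos_antisym [of i j k] by (simp add: godel_lanczos_def add.commute)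
  have "godel_lanczos a p i j k + godel_lanczos a p j k i + godel_lanczos a p k i j =
      a\<^sup>2 * (frame_lanczos i j k + frame_lanczos j k i + frame_lanczos k i j) *
      exp ((y_weight i + y_weight j + y_weight k) * p $ 2)"
    by (simp add: godel_lanczos_def algebra_simps)
  then show "godel_lanczos a p i j k + godel_lanczos a p j k i + godel_lanczos a p k i j = 0"
    by (simp add: frame_lanczos_cyclic)
  assume "(i, j, k) \<notin> {(1,2,3), (2,1,3), (1,3,2), (3,1,2), (1,2,1), (2,1,1),
      (2,3,3), (3,2,3), (2,3,1), (3,2,1)}"
  then have "frame_lanczos i j k = 0"
    by (rule frame_lanczos_eq_0)
  then show "godel_lanczos a p i j k = 0"
    by (simp add: godel_lanczos_def)
qed (simp_all add: godel_lanczos_def frame_lanczos_def y_weight_def)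

text \<open>Outside the ten listed triples the tensor is 0. Of these ten, four values are
  prescribed, one follows from the cyclic identity and the other five from antisymmetry.\<close>

lemma godel_lanczos_data_unique:
  assumes "godel_lanczos_data a L"
  shows "L = godel_lanczos a"
proof -
  note data = assms [unfolded godel_lanczos_data_def]
  note anti = data [THEN conjunct1, rule_format]
  note data = data [THEN conjunct2]
  note cyc = data [THEN conjunct1, rule_format]
  note data = data [THEN conjunct2]
  note L123 = data [THEN conjunct1, rule_format]
  note data = data [THEN conjunct2]
  note L132 = data [THEN conjunct1, rule_format]
  note data = data [THEN conjunct2]
  note L121 = data [THEN conjunct1, rule_format]
  note data = data [THEN conjunct2]
  note L233 = data [THEN conjunct1, rule_format]
  note zero = data [THEN conjunct2, rule_format]
  note vals = L123 L132 L121 L233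
  \<comment> \<open>The cyclic identity on \<open>(1,2,3)\<close>, with
    \<open>L p 3 1 2 = - L p 1 3 2\<close>, adds two equal contributions of 1/8.\<close>
  have vals': "L p 2 3 1 = a\<^sup>2 / 4 * exp (p $ 2)" for p
    using cyc [of p 1 2 3] anti [of p 3 1 2] vals [of p] by simp
  have "\<forall>i j k. L p i j k = godel_lanczos a p i j k" for p
    \<comment> \<open>Antisymmetry is supplied in one orientation only; as a general rewrite rule it
      would loop.\<close>
    using anti [of p 2 1] anti [of p 3 1] anti [of p 3 2]
    unfolding forall_4
    by (simp add: zero vals vals' godel_lanczos_def frame_lanczos_def y_weight_def)
  then show ?thesis by blast
qed

section \<open>The Riemann-Lanczos equations\<close>

text \<open>Each lower index pair admits at most two nonzero symbols. \<open>frame_riemann\<close>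
  and \<open>frame_dlanczos\<close> put the factor with upper index \<open>m\<close> first, so this
  rule removes all their sums before the cases are evaluated.\<close>

lemma frame_christoffel_contract:
  "(\<Sum>m\<in>UNIV. frame_christoffel m b c * f m) =
    (if (b, c) \<in> {(1,2), (2,1)} then f 1 - f 3
     else if (b, c) \<in> {(2,3), (3,2)} then f 1 / 2
     else if (b, c) \<in> {(1,3), (3,1), (3,3)} then f 2 / 2
     else 0)"
proof -
  have "\<forall>b c. (\<Sum>m\<in>UNIV. frame_christoffel m b c * f m) =
    (if (b, c) \<in> {(1,2), (2,1)} then f 1 - f 3
     else if (b, c) \<in> {(2,3), (3,2)} then f 1 / 2
     else if (b, c) \<in> {(1,3), (3,1), (3,3)} then f 2 / 2
     else 0)"
    unfolding forall_4 sum_4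
    by (simp add: frame_christoffel_def)
  then show ?thesis by blast
qed

lemma frame_metric_contract:
  "(\<Sum>m\<in>UNIV. frame_metric $ a $ m * f m) =
    (if a = 1 then f 1 + f 3 else if a = 3 then f 1 + f 3 / 2 else - f a)"
proof -
  have "\<forall>a. (\<Sum>m\<in>UNIV. frame_metric $ a $ m * f m) =
    (if a = 1 then f 1 + f 3 else if a = 3 then f 1 + f 3 / 2 else - f a)"
    unfolding forall_4 sum_4
    by (simp add: frame_metric_def vector_4)
  then show ?thesis by blast
qed

text \<open>As ready-made rewrite rules these spare the simplifier a slow modular computation for each of
  the many index comparisons in the next proof.\<close>

lemma index_4_neq:
  "(1::4) \<noteq> 2" "(1::4) \<noteq> 3" "(1::4) \<noteq> 4"
  "(2::4) \<noteq> 1" "(2::4) \<noteq> 3" "(2::4) \<noteq> 4"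
  "(3::4) \<noteq> 1" "(3::4) \<noteq> 2" "(3::4) \<noteq> 4"
  "(4::4) \<noteq> 1" "(4::4) \<noteq> 2" "(4::4) \<noteq> 3"
  by simp_all

text \<open>This is the whole tensor equation with \<open>a\<close> and the exponentials removed:
  256 identities between rational numbers.\<close>

lemma frame_riemann_lanczos:
  "(\<Sum>m\<in>UNIV. frame_metric $ a $ m * frame_riemann m b c d) =
     frame_dlanczos a b c d - frame_dlanczos a b d c
     + frame_dlanczos c d a b - frame_dlanczos c d b a"
proof -
  have "\<forall>a b c d. (\<Sum>m\<in>UNIV. frame_metric $ a $ m * frame_riemann m b c d) =
     frame_dlanczos a b c d - frame_dlanczos a b d c
     + frame_dlanczos c d a b - frame_dlanczos c d b a"
    unfolding forall_4 frame_metric_contract frame_riemann_def frame_dlanczos_def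
      frame_christoffel_contract
    \<comment> \<open>The restricted first pass decides the index comparisons; the second does the
      rational arithmetic.\<close>
    by (simp only: frame_christoffel_def frame_lanczos_def y_weight_def index_4_neq
        insert_iff empty_iff prod.inject simp_thms if_True if_False) simp
  then show ?thesis by blast
qed

lemma riemann_lanczos_godel:
  assumes "r \<noteq> 0"
  shows "riemann_lanczos (godel_metric r) (godel_lanczos r)"
  unfolding riemann_lanczos_def
proof (intro allI)
  fix p :: "real ^ 4" and a b c d :: 4
  \<comment> \<open>The four derivative terms permute the same indices, so their exponentials agree
    with that of the curvature.\<close>
  have "cov_deriv3 (godel_metric r) (godel_lanczos r) p i j k l = r\<^sup>2 * frame_dlanczos i j k l *
      exp ((y_weight a + y_weight b + y_weight c + y_weight d) * p $ 2)"
    if "y_weight i + y_weight j + y_weight k + y_weight l =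
      y_weight a + y_weight b + y_weight c + y_weight d" for i j k l
    using cov_deriv3_godel_lanczos [OF assms, of p i j k l] that by simp
  then show "riemann_down (godel_metric r) p a b c d =
      cov_deriv3 (godel_metric r) (godel_lanczos r) p a b c d
      - cov_deriv3 (godel_metric r) (godel_lanczos r) p a b d c
      + cov_deriv3 (godel_metric r) (godel_lanczos r) p c d a b
      - cov_deriv3 (godel_metric r) (godel_lanczos r) p c d b a"
    by (simp add: riemann_down_godel [OF assms] frame_riemann_lanczos
        distrib_left distrib_right left_diff_distrib right_diff_distrib)
qed

text \<open>Unique existence makes the claim about every \<open>L\<close> non-vacuous and reduces it
  to \<open>godel_lanczos a\<close>.\<close>

theorem mainTheorem2:
  fixes a :: real
  assumes "a > 0"
  shows "(\<exists>!L. godel_lanczos_data a L) \<and>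
    (\<forall>L. godel_lanczos_data a L \<longrightarrow>
      (\<forall>p. L p 2 3 1 = a\<^sup>2 / 4 * exp (p $ 2)) \<and>
      riemann_lanczos (godel_metric a) L \<and>
      (\<forall>i \<in> {1, 3, 4}. killing_field (godel_metric a) (coord_field i) \<and>
         (\<forall>p b c d. lie_deriv3 (coord_field i) L p b c d = 0)))"
proof -
  have ex1: "\<exists>!L. godel_lanczos_data a L"
    using godel_lanczos_data_godel_lanczos godel_lanczos_data_unique by (rule ex1I)
  have "\<forall>p. godel_lanczos a p 2 3 1 = a\<^sup>2 / 4 * exp (p $ 2)"
    by (simp add: godel_lanczos_def frame_lanczos_def y_weight_def)
  moreover have "riemann_lanczos (godel_metric a) (godel_lanczos a)"
    using assms by (intro riemann_lanczos_godel) simp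
  moreover have "\<forall>i \<in> {1, 3, 4}. killing_field (godel_metric a) (coord_field i) \<and>
      (\<forall>p b c d. lie_deriv3 (coord_field i) (godel_lanczos a) p b c d = 0)"
    \<comment> \<open>All components depend on \<open>x\<close> alone, so their derivatives along
      \<open>t\<close>, \<open>y\<close> and \<open>z\<close> vanish.\<close>
    by (simp add: killing_field_def lie_deriv2_coord_field lie_deriv3_coord_field
        pderiv_godel_metric frame_dmetric_def godel_lanczos_def pderiv_at_exp)
  ultimately have all: "(\<forall>p. L p 2 3 1 = a\<^sup>2 / 4 * exp (p $ 2)) \<and>
      riemann_lanczos (godel_metric a) L \<and>
      (\<forall>i \<in> {1, 3, 4}. killing_field (godel_metric a) (coord_field i) \<and>
         (\<forall>p b c d. lie_deriv3 (coord_field i) L p b c d = 0))"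
    if "godel_lanczos_data a L" for L
    unfolding godel_lanczos_data_unique [OF that] by (intro conjI)
  show ?thesis
    by (intro conjI [OF ex1] allI impI) (rule all)
qed

end
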